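(* Let $n_1,n_2\ge 1$, $n=n_1+n_2<m\le N$, let $\Phi\in\mathbb R^{N\times m}$ be a basis matrix, and let $S=[S_1\ \ S_2]\in\mathbb R^{N\times n}$ be a selection matrix with blocks $S_1\in\mathbb R^{N\times n_1}$ and $S_2\in\mathbb R^{N\times n_2}$. Assume that $S^\top\Phi$ has full rank $n$. Let $\mathbf u\in\mathbb R^N$, $\mathbf y=S^\top\mathbf u$, $\mathbf y_1=S_1^\top\mathbf u$, $\mathbf y_2=S_2^\top\mathbf u$. For $\mathbf z\in\mathcal N[S_1^\top\Phi]$ put $\mathbf c(\mathbf z)=(S_1^\top\Phi)^+\mathbf y_1+\mathbf z$ and $\tilde{\mathbf u}(\mathbf z)=\Phi\mathbf c(\mathbf z)$ (the S-DEIM reconstruction using only the first $n_1$ sensors). Let $\mathbf z$ be the minimum-norm solution of $$\min_{\mathbf z\in\mathcal N[S_1^\top\Phi]}\|S_2^\top\Phi\,\mathbf c(\mathbf z)-\mathbf y_2\|^2 .$$ Then $\tilde{\mathbf u}(\mathbf z)$ coincides with the vanilla DEIM reconstruction using all sensors: $$\tilde{\mathbf u}(\mathbf z)=\Phi(S^\top\Phi)^+\mathbf y .$$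
   Context: A basis matrix $\Phi\in\mathbb R^{N\times m}$ is a real matrix with orthonormal columns, $\Phi^\top\Phi=\mathbb I_m$. A selection matrix $S\in\mathbb R^{N\times n}$ is a matrix $[\mathbf e_{i_1}|\cdots|\mathbf e_{i_n}]$ whose columns are standard basis vectors of $\mathbb R^N$ with distinct indices. $A^+$ is the Moore--Penrose pseudoinverse of $A$, $\mathcal N[A]$ is its null space, and $\|\cdot\|$ is the Euclidean norm. The minimum-norm solution is the minimizer having smallest Euclidean norm among all minimizers. *)

theory Defs
  imports "HOL-Analysis.Analysis"
begin

definition basis_matrix :: "real ^ 'm ^ 'N \<Rightarrow> bool" where
  "basis_matrix \<Phi> \<longleftrightarrow> transpose \<Phi> ** \<Phi> = mat 1"

definition selection_matrix :: "real ^ 'n ^ 'N \<Rightarrow> bool" where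
  "selection_matrix S \<longleftrightarrow> (\<exists>i :: 'n \<Rightarrow> 'N. inj i \<and> (\<forall>j. column j S = axis (i j) 1))"

text \<open>The columns of the block matrix \<open>[S1 S2]\<close> are indexed by the sum type, whose
  cardinality is the sum of the two block widths.\<close>

definition hblock :: "real ^ 'n1 ^ 'N \<Rightarrow> real ^ 'n2 ^ 'N \<Rightarrow> real ^ ('n1 + 'n2) ^ 'N" where
  "hblock A B = (\<chi> r c. case c of Inl j \<Rightarrow> A $ r $ j | Inr j \<Rightarrow> B $ r $ j)"

definition null_space :: "real ^ 'n ^ 'm \<Rightarrow> (real ^ 'n) set" where
  "null_space A = {x. A *v x = 0}"

text \<open>The Moore--Penrose pseudoinverse is the unique solution of the four Penrose equations.\<close>

definition is_pinv :: "real ^ 'n ^ 'm \<Rightarrow> real ^ 'm ^ 'n \<Rightarrow> bool" where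
  "is_pinv A X \<longleftrightarrow>
     A ** X ** A = A \<and> X ** A ** X = X \<and>
     transpose (A ** X) = A ** X \<and> transpose (X ** A) = X ** A"

definition pinv :: "real ^ 'n ^ 'm \<Rightarrow> real ^ 'm ^ 'n" where
  "pinv A = (THE X. is_pinv A X)"

lemma is_pinv_unique:
  assumes X: "is_pinv A X" and Y: "is_pinv A Y"
  shows "X = Y"
proof -
  have x: "A ** X ** A = A" "X ** A ** X = X"
      "transpose (A ** X) = A ** X" "transpose (X ** A) = X ** A"
    and y: "A ** Y ** A = A" "Y ** A ** Y = Y"
      "transpose (A ** Y) = A ** Y" "transpose (Y ** A) = Y ** A"
    using X Y by (auto simp: is_pinv_def)
  have "A ** X = (A ** Y) ** (A ** X)"
    using y(1) by (simp add: matrix_mul_assoc)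
  also have "\<dots> = transpose ((A ** X) ** (A ** Y))"
    using x(3) y(3) by (simp add: matrix_transpose_mul)
  also have "(A ** X) ** (A ** Y) = A ** Y"
    using x(1) by (simp add: matrix_mul_assoc)
  finally have AX: "A ** X = A ** Y" using y(3) by simp
  have "X ** A = (X ** A) ** (Y ** A)"
    using y(1) by (simp flip: matrix_mul_assoc)
  also have "\<dots> = transpose ((Y ** A) ** (X ** A))"
    using x(4) y(4) by (simp add: matrix_transpose_mul)
  also have "(Y ** A) ** (X ** A) = Y ** A"
    using x(1) by (simp flip: matrix_mul_assoc)
  finally have XA: "X ** A = Y ** A" using y(4) by simp
  have "X = X ** A ** X" using x(2) by simp
  also have "\<dots> = Y ** A ** X" using XA by simp
  also have "\<dots> = Y ** A ** Y" using AX by (simp flip: matrix_mul_assoc)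
  finally show ?thesis using y(2) by simp
qed

lemma symmetric_inner_inverse_exists:
  fixes A :: "real ^ 'n ^ 'm"
  shows "\<exists>L. A ** L ** A = A \<and> transpose (A ** L) = A ** L"
proof -
  let ?T = "transpose A"
  let ?B = "?T ** A"
  obtain g where g: "linear g" "\<forall>v \<in> range ((*v) ?B). ?B *v g v = v"
    using linear_exists_right_inverse_on[OF matrix_vector_mul_linear[of ?B] subspace_UNIV] by auto
  define G where "G = matrix g"
  have kernel: "A *v w = 0" if "?B *v w = 0" for w
  proof -
    have "(A *v w) \<bullet> (A *v w) = ((A *v w) v* A) \<bullet> w"
      by (simp add: dot_lmul_matrix)
    also have "(A *v w) v* A = ?B *v w"
      by (simp flip: matrix_vector_mul_assoc)
    finally show ?thesis using that by simp
  qed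
  have "?B ** G ** ?B = ?B"
    using g by (simp add: matrix_eq G_def matrix_works flip: matrix_vector_mul_assoc)
  then have "?B *v ((G ** ?B) *v x - x) = 0" for x
    by (simp add: matrix_vector_mult_diff_distrib matrix_vector_mul_assoc matrix_mul_assoc)
  then have "A *v ((G ** ?B) *v x - x) = 0" for x
    using kernel by blast
  then have 1: "A ** (G ** ?B) = A"
    by (simp add: matrix_eq matrix_vector_mult_diff_distrib flip: matrix_vector_mul_assoc)
  have 2: "?T ** A ** transpose G ** ?T = ?T"
    using arg_cong[OF 1, of transpose] by (simp add: matrix_transpose_mul matrix_mul_assoc)
  have "A ** G ** ?T = A ** G ** (?T ** A ** transpose G ** ?T)" using 2 by simp
  also have "\<dots> = (A ** (G ** ?B)) ** transpose G ** ?T" by (simp add: matrix_mul_assoc)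
  also have "\<dots> = A ** transpose G ** ?T" using 1 by simp
  finally have "A ** G ** ?T = A ** transpose G ** ?T" .
  then have "transpose (A ** (G ** ?T)) = A ** (G ** ?T)"
    by (simp add: matrix_transpose_mul matrix_mul_assoc)
  moreover have "A ** (G ** ?T) ** A = A" using 1 by (simp add: matrix_mul_assoc)
  ultimately show ?thesis by blast
qed

lemma is_pinv_exists: "\<exists>X. is_pinv A X"
proof -
  obtain L where L: "A ** L ** A = A" "transpose (A ** L) = A ** L"
    using symmetric_inner_inverse_exists by blast
  obtain M where M: "transpose A ** M ** transpose A = transpose A"
      "transpose (transpose A ** M) = transpose A ** M"
    using symmetric_inner_inverse_exists by blast
  define R where "R = transpose M"
  have R: "A ** R ** A = A" "transpose (R ** A) = R ** A"
    using arg_cong[OF M(1), of transpose] M(2)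
    by (simp_all add: R_def matrix_transpose_mul matrix_mul_assoc)
  have AX: "A ** (R ** A ** L) = A ** L" using R by (simp add: matrix_mul_assoc)
  have XA: "R ** A ** L ** A = R ** A" using L by (simp flip: matrix_mul_assoc)
  have "R ** A ** L ** A ** (R ** A ** L) = R ** A ** L"
    using XA R(1) by (simp add: matrix_mul_assoc) (simp flip: matrix_mul_assoc)
  then have "is_pinv A (R ** A ** L)"
    using L R AX XA by (simp add: is_pinv_def)
  then show ?thesis ..
qed

lemma is_pinv_pinv: "is_pinv A (pinv A)"
  unfolding pinv_def using is_pinv_exists is_pinv_unique by (metis theI)

definition is_min_norm_solution ::
    "('a :: real_normed_vector \<Rightarrow> real) \<Rightarrow> 'a set \<Rightarrow> 'a \<Rightarrow> bool" where
  "is_min_norm_solution f K z \<longleftrightarrow> is_arg_min norm (is_arg_min f (\<lambda>x. x \<in> K)) z"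

definition sdeim_coeffs ::
    "real ^ 'm ^ 'N \<Rightarrow> real ^ 'n ^ 'N \<Rightarrow> real ^ 'n \<Rightarrow> real ^ 'm \<Rightarrow> real ^ 'm" where
  "sdeim_coeffs \<Phi> S y z = pinv (transpose S ** \<Phi>) *v y + z"

definition sdeim ::
    "real ^ 'm ^ 'N \<Rightarrow> real ^ 'n ^ 'N \<Rightarrow> real ^ 'n \<Rightarrow> real ^ 'm \<Rightarrow> real ^ 'N" where
  "sdeim \<Phi> S y z = \<Phi> *v sdeim_coeffs \<Phi> S y z"

definition deim :: "real ^ 'm ^ 'N \<Rightarrow> real ^ 'n ^ 'N \<Rightarrow> real ^ 'n \<Rightarrow> real ^ 'N" where
  "deim \<Phi> S y = \<Phi> *v (pinv (transpose S ** \<Phi>) *v y)"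

end

theory Submission
  imports Defs
begin

text \<open>Write \<open>A = S\<^sup>T \<Phi>\<close>, \<open>A\<^sub>1 = S\<^sub>1\<^sup>T \<Phi>\<close>, \<open>A\<^sub>2 = S\<^sub>2\<^sup>T \<Phi>\<close>, so that \<open>A\<close> is \<open>A\<^sub>1\<close> stacked on
  \<open>A\<^sub>2\<close>. Full row rank makes \<open>A x = y\<close> solvable, hence the vanilla DEIM coefficients
  \<open>d = A\<^sup>+ y\<close> interpolate all sensor data. Therefore \<open>p = d - A\<^sub>1\<^sup>+ y\<^sub>1\<close> lies in the null space
  of \<open>A\<^sub>1\<close> and gives residual zero, the least possible value, so that every minimizer \<open>x\<close> also
  interpolates all data and \<open>x - p\<close> lies in the null space of \<open>A\<close>.

  The range of a pseudoinverse is orthogonal to the null space of its matrix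
  (\<open>pinv_orthogonal_null_space\<close>). Both \<open>d\<close> and \<open>A\<^sub>1\<^sup>+ y\<^sub>1\<close> are thus orthogonal to the null space
  of \<open>A\<close>, the latter because that space is contained in the null space of \<open>A\<^sub>1\<close>. Hence \<open>p\<close> is
  orthogonal to \<open>x - p\<close>, and by Pythagoras \<open>p\<close> is the only minimizer of least norm
  (\<open>min_norm_eq_orthogonal_representative\<close>). So \<open>z = p\<close>, that is, \<open>A\<^sub>1\<^sup>+ y\<^sub>1 + z = d\<close>.\<close>

lemma pinv_solves_consistent_system:
  assumes "b \<in> range ((*v) A)"
  shows "A *v (pinv A *v b) = b"
  using assms is_pinv_pinv[of A]
  by (auto simp: is_pinv_def matrix_vector_mul_assoc matrix_mul_assoc)

text \<open>The matrix \<open>A\<^sup>+ A\<close> is symmetric and fixes every vector of the form \<open>A\<^sup>+ b\<close>, so in the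
  inner product it can be moved over to the null vector, which it kills.\<close>

lemma pinv_orthogonal_null_space:
  fixes A :: "real ^ 'n ^ 'm"
  assumes "w \<in> null_space A"
  shows "(pinv A *v b) \<bullet> w = 0"
proof -
  let ?P = "pinv A ** A"
  have "?P *v (pinv A *v b) = pinv A *v b" and sym: "transpose ?P = ?P"
    using is_pinv_pinv[of A] by (simp_all add: is_pinv_def matrix_vector_mul_assoc)
  then have "(pinv A *v b) \<bullet> w = (transpose ?P *v (pinv A *v b)) \<bullet> w"
    by simp
  also have "\<dots> = (pinv A *v b) \<bullet> (?P *v w)"
    by (simp add: dot_lmul_matrix)
  also have "?P *v w = 0"
    using assms by (simp add: null_space_def flip: matrix_vector_mul_assoc)
  finally show ?thesis by simp
qed

lemma transpose_hblock_mult_eq_iff: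
  "transpose (hblock A B) *v x = transpose (hblock A B) *v x' \<longleftrightarrow>
     transpose A *v x = transpose A *v x' \<and> transpose B *v x = transpose B *v x'"
proof -
  have "(transpose (hblock A B) *v v) $ Inl j = (transpose A *v v) $ j"
    and "(transpose (hblock A B) *v v) $ Inr k = (transpose B *v v) $ k" for v j k
    by (simp_all add: hblock_def matrix_vector_mult_def transpose_def)
  then show ?thesis
    by (simp add: vec_eq_iff split_sum_all)
qed

text \<open>Pythagoras: a minimizer that is orthogonal to its difference from \<open>z\<close> is strictly shorter
  than \<open>z\<close> unless the two coincide.\<close>

lemma min_norm_eq_orthogonal_representative:
  fixes p z :: "'a :: real_inner"
  assumes "is_min_norm_solution f K z"
    and "is_arg_min f (\<lambda>x. x \<in> K) p"
    and "p \<bullet> (z - p) = 0"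
  shows "z = p"
proof -
  have "norm z \<le> norm p"
    using assms(1,2) by (auto simp: is_min_norm_solution_def is_arg_min_linorder)
  then have "(norm z)\<^sup>2 \<le> (norm p)\<^sup>2"
    by (simp add: power_mono)
  moreover have "(norm z)\<^sup>2 = (norm p)\<^sup>2 + (norm (z - p))\<^sup>2"
    using norm_add_Pythagorean[of p "z - p"] assms(3) by (simp add: orthogonal_def)
  ultimately show ?thesis by simp
qed

theorem theorem2:
  fixes \<Phi> :: "real ^ 'm ^ 'N"
    and S1 :: "real ^ 'n1 ^ 'N"
    and S2 :: "real ^ 'n2 ^ 'N"
    and S :: "real ^ ('n1 + 'n2) ^ 'N"
    and u :: "real ^ 'N"
    and y :: "real ^ ('n1 + 'n2)"
    and y1 :: "real ^ 'n1"
    and y2 :: "real ^ 'n2"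
    and z :: "real ^ 'm"
  assumes "CARD('n1) + CARD('n2) < CARD('m)"
    and "CARD('m) \<le> CARD('N)"
    and "basis_matrix \<Phi>"
    and "S = hblock S1 S2"
    and "selection_matrix S"
    and "rank (transpose S ** \<Phi>) = CARD('n1) + CARD('n2)"
    and "y = transpose S *v u"
    and "y1 = transpose S1 *v u"
    and "y2 = transpose S2 *v u"
    and "is_min_norm_solution
           (\<lambda>z. (norm ((transpose S2 ** \<Phi>) *v sdeim_coeffs \<Phi> S1 y1 z - y2))\<^sup>2)
           (null_space (transpose S1 ** \<Phi>)) z"
  shows "sdeim \<Phi> S1 y1 z = deim \<Phi> S y"
proof -
  let ?A = "transpose S ** \<Phi>"
  let ?A1 = "transpose S1 ** \<Phi>"
  let ?A2 = "transpose S2 ** \<Phi>"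
  let ?K = "null_space ?A1"
  let ?f = "\<lambda>z. (norm (?A2 *v sdeim_coeffs \<Phi> S1 y1 z - y2))\<^sup>2"
  define d where "d = pinv ?A *v y"
  define c1 where "c1 = pinv ?A1 *v y1"
  define p where "p = d - c1"

  have stack: "?A *v x = y \<longleftrightarrow> ?A1 *v x = y1 \<and> ?A2 *v x = y2" for x
    using transpose_hblock_mult_eq_iff[of S1 S2 "\<Phi> *v x" u] assms(4,7-9)
    by (simp flip: matrix_vector_mul_assoc)
  have stack0: "?A *v x = 0 \<longleftrightarrow> ?A1 *v x = 0 \<and> ?A2 *v x = 0" for x
    using transpose_hblock_mult_eq_iff[of S1 S2 "\<Phi> *v x" 0] assms(4)
    by (simp flip: matrix_vector_mul_assoc)

  have "surj ((*v) ?A)"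
    using assms(6) by (simp flip: full_rank_surjective)
  then have Ad: "?A *v d = y"
    unfolding d_def by (intro pinv_solves_consistent_system) auto
  then have "y1 \<in> range ((*v) ?A1)"
    using stack[of d] by auto
  then have A1c1: "?A1 *v c1 = y1"
    unfolding c1_def by (rule pinv_solves_consistent_system)

  have "p \<in> ?K" and "?f p = 0"
    using Ad A1c1 stack[of d]
    by (simp_all add: p_def null_space_def sdeim_coeffs_def c1_def matrix_vector_mult_diff_distrib)
  then have p_min: "is_arg_min ?f (\<lambda>x. x \<in> ?K) p"
    by (simp add: is_arg_min_linorder)

  have z_min: "is_arg_min ?f (\<lambda>x. x \<in> ?K) z"
    using assms(10) by (simp add: is_min_norm_solution_def is_arg_min_def)
  then have "z \<in> ?K" and "?f z \<le> ?f p"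
    using \<open>p \<in> ?K\<close> by (auto simp: is_arg_min_linorder)
  with \<open>?f p = 0\<close> have "?A1 *v (c1 + z) = y1" and "?A2 *v (c1 + z) = y2"
    using A1c1
    by (simp_all add: null_space_def sdeim_coeffs_def c1_def matrix_vector_right_distrib)
  then have "?A *v (c1 + z) = ?A *v d"
    using Ad stack[of "c1 + z"] by simp
  then have "?A *v (z - p) = 0"
    by (simp add: p_def matrix_vector_mult_diff_distrib matrix_vector_right_distrib algebra_simps)
  then have "z - p \<in> null_space ?A" and "z - p \<in> ?K"
    using stack0 by (simp_all add: null_space_def)
  then have "p \<bullet> (z - p) = 0"
    unfolding p_def d_def c1_def
    by (simp add: inner_diff_left pinv_orthogonal_null_space)
  then have "z = p"
    by (rule min_norm_eq_orthogonal_representative[OF assms(10) p_min])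
  then show ?thesis
    by (simp add: sdeim_def deim_def sdeim_coeffs_def p_def d_def c1_def)
qed

end
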